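(* Let $m\geq 2$ be an integer and let $n=2^{m+1}-4$. Then the set $\{P_0,\dots,P_m\}$ is a Gröbner basis of the ideal $J_n\subset \mathbb{Z}/2[\bar w_2,\bar w_3]$, with respect to the lexicographic order in which $\bar w_2^p\bar w_3^q\geq \bar w_2^r\bar w_3^s$ if and only if $p>r$, or $p=r$ and $q\geq s$.
   Context: Ideal: $J_n$ is the ideal of $\mathbb{Z}/2[\bar w_2,\bar w_3]$ generated by $g_{n+1},g_{n+2},g_{n+3}$, where $$g_r=\sum_{\frac r3\leq s\leq \frac r2}\binom{s}{3s-r}\bar w_2^{3s-r}\bar w_3^{r-2s}.$$ (Equivalently, $g_r$ is the degree $r$ homogeneous component of $1/(1+\bar w_2+\bar w_3)$, where $\deg\bar w_i=i$.) Binary expansions: for $0\leq x<2^k$, $\epsilon_k(x)=(x_{k-1},\dots,x_0)\in\{0,1\}^k$ is defined by $x=\sum_{i=0}^{k-1}x_i2^i$. For $k\ge 0$, $\Delta_k\subset\{0,1\}^k$ is the set of sequences $(p_{k-1},\dots,p_0)$ such that, with the conventions $p_{-1}=1$ and $p_k=1$: whenever $0\le l\le l+2t\le k-1$, $t\geq 0$, $p_{l-1}=1$ and $p_l=p_{l+1}=\cdots=p_{l+2t}=0$, then $p_{l+2t+1}=0$. Equivalently, every maximal block of consecutive zeros has even length. ($\Delta_0$ consists of the empty sequence.) Polynomials: for integers $0\leq i\leq m$ and $t\geq 0$ with $t-2(2^m-2^i)\equiv 0\pmod 3$, let $$P(t,i)=\sum_{p}\bar w_2^{p}\,\bar w_3^{(t-2p)/3},$$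 where $p$ runs over the integers $0\le p<2^m$ such that $t-2p\geq 0$ and $\epsilon_m(p)=(\mathbf{p}_{m-i},0,\dots,0)$ (with $i$ final zeros) for some $\mathbf{p}_{m-i}\in\Delta_{m-i}$. For $0\leq i\leq m$ put $P_i=P(2^i+n+1,i)$. A finite subset $\{G_1,\dots,G_s\}$ of an ideal $I$ is a Gröbner basis of $I$ if the ideal generated by the leading terms of all (nonzero) elements of $I$ equals the ideal generated by the leading terms of $G_1,\dots,G_s$. *)

theory Defs
  imports
    Complex_Main
    "HOL-Library.Poly_Mapping"
    "HOL-Library.Product_Plus"
    "HOL-Library.Product_Lexorder"
    "HOL-Library.Z2"
begin

section \<open>The polynomial ring and its ideals\<close>

text \<open>
  The exponent pair \<open>(p, q)\<close> stands for the monomial \<open>w\<^sub>2\<^sup>p w\<^sub>3\<^sup>q\<close>; addition of exponent pairs is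
  componentwise, so the multiplication of \<^typ>\<open>(nat \<times> nat) \<Rightarrow>\<^sub>0 bit\<close> (convolution) is that of
  \<open>\<int>/2[w\<^sub>2, w\<^sub>3]\<close>.
\<close>

type_synonym pol = "(nat \<times> nat) \<Rightarrow>\<^sub>0 bit"

definition w2 :: pol where "w2 = Poly_Mapping.single (1, 0) 1"

definition w3 :: pol where "w3 = Poly_Mapping.single (0, 1) 1"

lemma module_times: "module ((*) :: 'a::comm_ring_1 \<Rightarrow> 'a \<Rightarrow> 'a)"
  by unfold_locales (simp_all add: algebra_simps)

definition ideal_gen :: "'a::comm_ring_1 set \<Rightarrow> 'a set"
  where "ideal_gen B = module.span (*) B"

lemma ideal_gen_explicit:
  "ideal_gen B = {\<Sum>b\<in>T. r b * b | T r. finite T \<and> T \<subseteq> B}"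
  unfolding ideal_gen_def by (rule module.span_explicit[OF module_times])


section \<open>Leading terms and Groebner bases\<close>

text \<open>Exponent pairs are ordered lexicographically by \<^theory>\<open>HOL-Library.Product_Lexorder\<close>:\<close>

lemma exponent_order:
  "(p, q) \<ge> (r, s) \<longleftrightarrow> p > r \<or> p = r \<and> q \<ge> s" for p q r s :: nat
  by auto

text \<open>The case \<open>f = 0\<close> only makes the function total.\<close>

definition lead_term :: "pol \<Rightarrow> pol" where
  "lead_term f =
     (if f = 0 then 0
      else let e = Max (Poly_Mapping.keys f)
           in Poly_Mapping.single e (Poly_Mapping.lookup f e))"

definition groebner_basis :: "pol set \<Rightarrow> pol set \<Rightarrow> bool" where
  "groebner_basis G I \<longleftrightarrow>
     finite G \<and> G \<subseteq> I \<and>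
     ideal_gen (lead_term ` (I - {0})) = ideal_gen (lead_term ` G)"


section \<open>The ideals \<open>J\<^sub>n\<close>\<close>

definition g :: "nat \<Rightarrow> pol" where
  "g r = (\<Sum>s | r \<le> 3 * s \<and> 2 * s \<le> r.
            of_nat (s choose (3 * s - r)) * w2 ^ (3 * s - r) * w3 ^ (r - 2 * s))"

definition J :: "nat \<Rightarrow> pol set" where
  "J n = ideal_gen {g (n + 1), g (n + 2), g (n + 3)}"


section \<open>Binary expansions and the polynomials \<open>P\<close>\<close>

text \<open>
  A sequence \<open>(p\<^bsub>k-1\<^esub>, \<dots>, p\<^sub>0)\<close> of binary digits is a list written in this order, so its head
  is the most significant digit.
\<close>

definition eps :: "nat \<Rightarrow> nat \<Rightarrow> nat list" where
  "eps k x = map (\<lambda>i. x div 2 ^ i mod 2) (rev [0..<k])"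

text \<open>
  \<open>entry ps j\<close> is \<open>p\<^sub>j\<close>, including the conventions \<open>p\<^bsub>-1\<^esub> = 1\<close> and \<open>p\<^sub>k = 1\<close>.
\<close>

definition entry :: "nat list \<Rightarrow> int \<Rightarrow> nat" where
  "entry ps j = (if 0 \<le> j \<and> j < int (length ps) then rev ps ! nat j else 1)"

lemma eps_expansion:
  assumes "x < 2 ^ k"
  shows "x = (\<Sum>i<k. entry (eps k x) (int i) * 2 ^ i)"
proof -
  have "x mod 2 ^ k = (\<Sum>i<k. (x div 2 ^ i mod 2) * 2 ^ i)"
  proof (induction k)
    case (Suc k)
    have "x mod 2 ^ Suc k = 2 ^ k * (x div 2 ^ k mod 2) + x mod 2 ^ k"
      using mod_mult2_eq[of x "2 ^ k" 2] by (simp only: power_Suc2)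
    then show ?case
      using Suc.IH by (simp only: sum.lessThan_Suc mult.commute add.commute)
  qed simp
  moreover have "entry (eps k x) (int i) = x div 2 ^ i mod 2" if "i < k" for i
    using that by (simp add: entry_def eps_def rev_map)
  ultimately show ?thesis
    using assms by simp
qed

definition Delta :: "nat \<Rightarrow> nat list set" where
  "Delta k = {ps. length ps = k \<and> set ps \<subseteq> {0, 1} \<and>
     (\<forall>l t. l + 2 * t < k \<and> entry ps (int l - 1) = 1 \<and>
            (\<forall>j\<in>{l..l + 2 * t}. entry ps (int j) = 0)
        \<longrightarrow> entry ps (int (l + 2 * t + 1)) = 0)}"

text \<open>
  \<open>P m t i\<close> is used for \<open>i \<le> m\<close> and \<open>t - 2(2\<^sup>m - 2\<^sup>i) \<equiv> 0 (mod 3)\<close>. For the \<open>p\<close> occurring in the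
  sum one then has \<open>t - 2p \<equiv> 0 (mod 3)\<close>, because every maximal block of zeros among the digits
  above the last \<open>i\<close> ones has even length and \<open>2\<^sup>j + 2\<^bsup>j+1\<^esup>\<close> is divisible by 3; hence the
  division below is exact.
\<close>

definition P :: "nat \<Rightarrow> nat \<Rightarrow> nat \<Rightarrow> pol" where
  "P m t i =
     (\<Sum>p | p < 2 ^ m \<and> 2 * p \<le> t \<and> (\<exists>ps\<in>Delta (m - i). eps m p = ps @ replicate i 0).
        w2 ^ p * w3 ^ ((t - 2 * p) div 3))"

end

theory Submission
  imports Defs
begin

text \<open>
  Put \<open>N = 2\<^bsup>m+1\<^esup>\<close>. The splitting of admissible binary sequences by their last block yields
  \<open>w\<^sub>3\<^bsup>2^i\<^esup> P\<^sub>i = w\<^sub>2\<^bsup>2^i\<^esup> P\<^bsub>i+1\<^esub> + P\<^bsub>i+2\<^esub>\<close>, with \<open>P\<^bsub>m+1\<^esub> = 0\<close>. Iterating the recursion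
  of \<open>g\<close> in characteristic 2 shows that the \<open>g\<^bsub>2^i+N-3\<^esub>\<close> satisfy the same relation, and the
  doubling formula \<open>g\<^bsub>2r+3\<^esub> = w\<^sub>3 g\<^sub>r\<^sup>2\<close> gives the same values at \<open>i = m, m+1\<close>. Cancelling powers
  of \<open>w\<^sub>3\<close>, \<open>P\<^sub>i = g\<^bsub>2^i+N-3\<^esub>\<close> for all \<open>i\<close>; since also \<open>g\<^bsub>N-3\<^esub> = 0\<close>, the ideal is generated by
  \<open>P\<^sub>0\<close> and \<open>P\<^sub>1\<close>.

  The relation also rewrites every element of the ideal as a sum of distinct products
  \<open>w\<^sub>2\<^sup>u w\<^sub>3\<^sup>v P\<^sub>i\<close> with \<open>v < 2\<^sup>i\<close> or \<open>i = m\<close>. The leading exponent of such a product is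
  \<open>(u + 2\<^sup>m - 2\<^sup>i, v + 2\<^sup>i - 1)\<close>, whose second entry determines \<open>i\<close>. Hence the leading terms do not
  cancel, and the leading term of the sum is a multiple of some leading term of a \<open>P\<^sub>i\<close>.
\<close>

section \<open>Polynomials over the two-element field\<close>

text \<open>Addition of exponents respects the lexicographic order, so leading exponents add up when
  a polynomial is multiplied by a monomial.\<close>

instance prod ::
  ("{ordered_cancel_comm_monoid_add, linorder}", "{ordered_cancel_comm_monoid_add, linorder}")
    ordered_cancel_comm_monoid_add
  by standard (auto simp: less_eq_prod_def add_strict_left_mono add_left_mono)

abbreviation mon :: "nat \<times> nat \<Rightarrow> pol" where
  "mon e \<equiv> Poly_Mapping.single e 1"

lemma bit_add_self [simp]: "x + x = (0::bit)"
  by (cases x) simp_all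

lemma pol_add_self: "f + f = (0::pol)"
  by (rule poly_mapping_eqI) (simp only: lookup_add bit_add_self lookup_zero)

lemma pol_two [simp]: "(2::pol) = 0"
  using pol_add_self[of 1] by (metis one_add_one)

lemma pol_square_add: "(f + h)\<^sup>2 = f\<^sup>2 + (h::pol)\<^sup>2"
  by (simp add: power2_sum)

lemma mon_mult: "mon d * mon e = mon (d + e)"
  by (simp add: mult_single)

lemma w2_power: "w2 ^ p = mon (p, 0)"
  by (induction p) (simp_all add: w2_def mon_mult zero_prod_def[symmetric])

lemma w3_power: "w3 ^ q = mon (0, q)"
  by (induction q) (simp_all add: w3_def mon_mult zero_prod_def[symmetric])

lemma monomial_eq_mon: "w2 ^ p * w3 ^ q = mon (p, q)"
  by (simp add: w2_power w3_power mon_mult)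

text \<open>All nonzero coefficients are 1, so the support determines the polynomial.\<close>

lemma pol_eq_sum_mon: "f = (\<Sum>e\<in>Poly_Mapping.keys f. mon e)" for f :: pol
proof (rule poly_mapping_eqI)
  fix k
  have "Poly_Mapping.lookup (\<Sum>e\<in>Poly_Mapping.keys f. mon e) k
      = (\<Sum>e\<in>Poly_Mapping.keys f. if e = k then 1 else 0)"
    by (simp add: lookup_sum lookup_single when_def)
  also have "\<dots> = Poly_Mapping.lookup f k"
    by (simp add: in_keys_iff)
  finally show "Poly_Mapping.lookup f k = Poly_Mapping.lookup (\<Sum>e\<in>Poly_Mapping.keys f. mon e) k" ..
qed

lemma lookup_mon_mult:
  "Poly_Mapping.lookup (mon d * f) k = (\<Sum>e\<in>Poly_Mapping.keys f. if d + e = k then 1 else 0)"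
  by (subst pol_eq_sum_mon[of f])
     (simp add: sum_distrib_left mon_mult lookup_sum lookup_single when_def)

lemma lookup_mon_mult_add [simp]:
  "Poly_Mapping.lookup (mon d * f) (d + e) = Poly_Mapping.lookup f e"
  by (simp add: lookup_mon_mult in_keys_iff)

lemma lookup_w2_mult: "Poly_Mapping.lookup (w2 * f) (i, l) =
    (if i = 0 then 0 else Poly_Mapping.lookup f (i - 1, l))"
  using lookup_mon_mult_add[of "(1,0)" f "(i - 1, l)"]
  by (cases "i = 0") (auto simp: w2_def lookup_mon_mult[of _ _ "(0, l)"] intro!: sum.neutral)

lemma lookup_w3_mult: "Poly_Mapping.lookup (w3 * f) (i, l) =
    (if l = 0 then 0 else Poly_Mapping.lookup f (i, l - 1))"
  using lookup_mon_mult_add[of "(0,1)" f "(i, l - 1)"]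
  by (cases "l = 0") (auto simp: w3_def lookup_mon_mult[of _ _ "(i, 0)"] intro!: sum.neutral)

section \<open>Recursions of the polynomials \<open>g\<close>\<close>

text \<open>The two exponents in the summand with index \<open>s\<close> add up to \<open>s\<close>,
  so each monomial comes from one summand only. Identities for \<open>g\<close> can then be checked
  coefficientwise, without truncated subtraction.\<close>

lemma lookup_g: "Poly_Mapping.lookup (g r) (i, l) =
    (if 2 * i + 3 * l = r then of_nat ((i + l) choose i) else 0)"
proof -
  let ?S = "{s. r \<le> 3 * s \<and> 2 * s \<le> r}"
  have fin: "finite ?S"
    by (rule finite_subset[of _ "{..r}"]) auto
  have "g r = (\<Sum>s\<in>?S. Poly_Mapping.single (3 * s - r, r - 2 * s) (of_nat (s choose (3 * s - r))))"
    unfolding g_def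
    by (intro sum.cong refl)
       (simp add: mult.assoc monomial_eq_mon single_of_nat[symmetric] mult_single del: single_of_nat)
  then have "Poly_Mapping.lookup (g r) (i, l) =
      (\<Sum>s\<in>?S. if (3 * s - r, r - 2 * s) = (i, l) then of_nat (s choose (3 * s - r)) else 0)"
    by (simp add: lookup_sum lookup_single when_def)
  also have "\<dots> = (\<Sum>s\<in>?S. if s = i + l \<and> 2 * i + 3 * l = r then of_nat ((i + l) choose i) else 0)"
    by (intro sum.cong refl) auto
  also have "\<dots> = (if 2 * i + 3 * l = r then of_nat ((i + l) choose i) else 0)"
    using fin by (auto simp: sum.delta)
  finally show ?thesis .
qed

text \<open>Pascal's rule in each coefficient; equivalently, 1 + w2 + w3 times the sum of all
  \<open>g r\<close> is 1.\<close>

lemma g_rec: "g (r + 3) = w2 * g (r + 1) + w3 * g r"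
proof (rule poly_mapping_eqI)
  fix k :: "nat \<times> nat"
  obtain i l where k: "k = (i, l)" by (cases k)
  show "Poly_Mapping.lookup (g (r + 3)) k = Poly_Mapping.lookup (w2 * g (r + 1) + w3 * g r) k"
    unfolding k lookup_add lookup_w2_mult lookup_w3_mult lookup_g
    by (cases i; cases l) (auto simp: of_nat_add simp del: add_bit_eq_xor)
qed

lemma g_0: "g 0 = 1"
proof (rule poly_mapping_eqI)
  fix k :: "nat \<times> nat"
  show "Poly_Mapping.lookup (g 0) k = Poly_Mapping.lookup 1 k"
    by (cases k) (auto simp: lookup_g lookup_one when_def zero_prod_def)
qed

lemma g_1: "g 1 = 0"
proof (rule poly_mapping_eqI)
  fix k :: "nat \<times> nat"
  show "Poly_Mapping.lookup (g 1) k = Poly_Mapping.lookup 0 k"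
    by (cases k) (auto simp: lookup_g, presburger)
qed

lemma g_2: "g 2 = w2"
proof (rule poly_mapping_eqI)
  fix k :: "nat \<times> nat"
  obtain i l where k: "k = (i, l)" by (cases k)
  have "2 * i + 3 * l = 2 \<longleftrightarrow> i = 1 \<and> l = 0" by presburger
  then show "Poly_Mapping.lookup (g 2) k = Poly_Mapping.lookup w2 k"
    by (auto simp: k lookup_g w2_def lookup_single when_def)
qed

text \<open>With S the index shift, \<open>g_rec\<close> reads S^3 = w2 S + w3; squaring it j times
  in characteristic 2 gives this relation. In the induction step the two mixed terms cancel.\<close>

lemma g_rec_pow:
  "g (r + 3 * 2 ^ j) = w2 ^ 2 ^ j * g (r + 2 ^ j) + w3 ^ 2 ^ j * g r"
proof (induction j arbitrary: r)
  case 0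
  show ?case using g_rec[of r] by simp
next
  case (Suc j)
  let ?k = "2 ^ j :: nat" and ?a = "w2 ^ 2 ^ j" and ?b = "w3 ^ 2 ^ j"
  have "g (r + 3 * 2 ^ Suc j) = ?a * g ((r + ?k) + 3 * ?k) + ?b * g (r + 3 * ?k)"
    using Suc[of "r + 3 * ?k"] by (simp add: algebra_simps)
  also have "\<dots> = ?a * (?a * g ((r + ?k) + ?k) + ?b * g (r + ?k)) + ?b * (?a * g (r + ?k) + ?b * g r)"
    by (simp only: Suc)
  also have "\<dots> = ?a * ?a * g (r + 2 ^ Suc j) + ?b * ?b * g r + (?a * ?b * g (r + ?k) + ?a * ?b * g (r + ?k))"
    by (simp add: algebra_simps mult_2[of ?k])
  also have "\<dots> = w2 ^ 2 ^ Suc j * g (r + 2 ^ Suc j) + w3 ^ 2 ^ Suc j * g r"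
    by (simp only: pol_add_self power_Suc mult_2 power_add add.assoc add_0_right)
  finally show ?case .
qed

text \<open>The sum G of all \<open>g r\<close> satisfies G = (1 + w2 + w3) G^2, and G^2 is the sum
  of the squares; compare degrees. The induction proves both parities together because the recursion
  mixes them.\<close>

lemma g_doubling: "g (2 * r + 2) = (g (r + 1))\<^sup>2 + w2 * (g r)\<^sup>2 \<and> g (2 * r + 3) = w3 * (g r)\<^sup>2"
proof (induction r rule: induct_nat_012)
  case 0
  show ?case using g_rec[of 0] g_0 g_1 g_2 by (simp add: numeral_2_eq_2)
next
  case 1
  have "g 3 = w3" "g 4 = w2\<^sup>2"
    using g_rec[of 0] g_rec[of 1] g_0 g_1 g_2 by (simp_all add: power2_eq_square numeral_2_eq_2)
  moreover have "g 5 = w2 * g 3 + w3 * g 2"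
    using g_rec[of 2] by simp
  ultimately show ?case using g_1 g_2
    by (simp add: mult.commute numeral_eq_Suc pol_add_self)
next
  case (ge2 r)
  have e: "g (2 * r + 6) = w2 * g (2 * r + 4) + w3 * g (2 * r + 3)"
    "g (2 * r + 7) = w2 * g (2 * r + 5) + w3 * g (2 * r + 4)"
    using g_rec[of "2 * r + 3"] g_rec[of "2 * r + 4"] by (simp_all add: eval_nat_numeral)
  have ih: "g (2 * r + 3) = w3 * (g r)\<^sup>2" "g (2 * r + 5) = w3 * (g (r + 1))\<^sup>2"
    "g (2 * r + 4) = (g (r + 2))\<^sup>2 + w2 * (g (r + 1))\<^sup>2"
    using ge2 by (simp_all add: eval_nat_numeral)
  have sq: "(g (r + 3))\<^sup>2 = w2\<^sup>2 * (g (r + 1))\<^sup>2 + w3\<^sup>2 * (g r)\<^sup>2"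
    by (simp add: g_rec pol_square_add power_mult_distrib)
  have "g (2 * r + 6) = (g (r + 3))\<^sup>2 + w2 * (g (r + 2))\<^sup>2"
    unfolding e ih sq by (simp add: algebra_simps power2_eq_square)
  moreover have "g (2 * r + 7) = w3 * (g (r + 2))\<^sup>2 +
      (w2 * w3 * (g (r + 1))\<^sup>2 + w2 * w3 * (g (r + 1))\<^sup>2)"
    unfolding e ih by (simp add: algebra_simps)
  ultimately show ?case
    unfolding pol_add_self by (simp add: eval_nat_numeral)
qed

text \<open>The map r -> 2r + 3 sends 2^j - 3 to 2^(j+1) - 3, so the vanishing of \<open>g 1\<close>
  propagates.\<close>

lemma g_pow2_minus_3: "g (2 ^ (k + 2) - 3) = 0"
proof (induction k)
  case 0
  show ?case using g_1 by simp
next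
  case (Suc k)
  have "(2::nat)\<^sup>2 \<le> 2 ^ (k + 2)" by (intro power_increasing) auto
  then have "2 * (2 ^ (k + 2) - 3) + 3 = 2 ^ (Suc k + 2) - (3::nat)"
    unfolding add_Suc power_Suc[of _ "k + 2"] power2_eq_square by linarith
  then show ?case
    using g_doubling[of "2 ^ (k + 2) - 3"] Suc by simp
qed

text \<open>The same map starting from \<open>g 0 = 1\<close>; each step turns the exponent e of w3
  into 2e + 1.\<close>

lemma g_three_pow2_minus_3: "g (3 * 2 ^ k - 3) = w3 ^ (2 ^ k - 1)"
proof (induction k)
  case 0
  show ?case using g_0 by simp
next
  case (Suc k)
  have "(1::nat) \<le> 2 ^ k" by simp
  then have e: "2 * (3 * 2 ^ k - 3) + 3 = 3 * 2 ^ Suc k - (3::nat)"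
    "2 ^ Suc k - 1 = Suc (2 * (2 ^ k - (1::nat)))"
    unfolding power_Suc by linarith+
  show ?case
    unfolding e(1)[symmetric] e(2)
    using g_doubling[of "3 * 2 ^ k - 3"] Suc by (simp add: power_even_eq)
qed

section \<open>Admissible binary sequences\<close>

text \<open>Encoding admissible sequences by their values makes appending final digits 1 or 00 the
  maps x -> 2x + 1 and x -> 4x.\<close>

definition delta_nats :: "nat \<Rightarrow> nat set" where
  "delta_nats k = {x. x < 2 ^ k \<and> eps k x \<in> Delta k}"

lemma entry_snoc:
  "entry (q @ [x]) (int j) = (if j = 0 then x else entry q (int j - 1))"
  by (auto simp: entry_def nth_Cons' nat_diff_distrib)

lemma entry_minus_1 [simp]: "entry q (- 1) = 1"
  by (simp add: entry_def)

lemma DeltaD: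
  assumes "ps \<in> Delta k" "l + 2 * t < k" "entry ps (int l - 1) = 1"
    "\<And>j. l \<le> j \<Longrightarrow> j \<le> l + 2 * t \<Longrightarrow> entry ps (int j) = 0"
  shows "entry ps (int (l + 2 * t + 1)) = 0"
  using assms unfolding Delta_def by (auto simp del: of_nat_add of_nat_Suc of_nat_mult)

lemma entry_snoc_Suc: "entry (q @ [x]) (int (Suc j)) = entry q (int j)"
  by (simp only: entry_snoc) simp

text \<open>An appended 1 takes over the role of the convention p_{-1} = 1, so the digit below a
  block is unaffected by the shift.\<close>

lemma entry_snoc1_pred: "entry (q @ [1]) (int j - 1) = entry q (int j - 2)"
proof (cases j)
  case (Suc j')
  then show ?thesis using entry_snoc[of q 1 j'] by (auto simp: entry_def)
qed (simp add: entry_def)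

text \<open>The final 1 lies in no block of zeros; all blocks are merely shifted by one
  place.\<close>

lemma Delta_snoc_1: "q @ [1] \<in> Delta (Suc k) \<longleftrightarrow> q \<in> Delta k"
proof
  assume A: "q @ [1] \<in> Delta (Suc k)"
  show "q \<in> Delta k"
    unfolding Delta_def
  proof (intro CollectI conjI allI impI; (elim conjE)?)
    fix l t
    assume B: "l + 2 * t < k" "entry q (int l - 1) = 1" "\<forall>j\<in>{l..l + 2 * t}. entry q (int j) = 0"
    have "entry (q @ [1]) (int (Suc l + 2 * t + 1)) = 0"
    proof (rule DeltaD[OF A])
      show "entry (q @ [1]) (int (Suc l) - 1) = 1"
        using B(2) by (simp only: entry_snoc1_pred) simp
      fix j :: nat
      assume "Suc l \<le> j" "j \<le> Suc l + 2 * t"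
      then show "entry (q @ [1]) (int j) = 0"
        using bspec[OF B(3), of "j - 1"] by (cases j) (simp_all only: entry_snoc_Suc, simp_all)
    qed (use B in simp)
    then show "entry q (int (l + 2 * t + 1)) = 0"
      using entry_snoc_Suc[of q 1 "l + 2 * t + 1"] by simp
  qed (use A in \<open>auto simp: Delta_def\<close>)
next
  assume A: "q \<in> Delta k"
  show "q @ [1] \<in> Delta (Suc k)"
    unfolding Delta_def
  proof (intro CollectI conjI allI impI; (elim conjE)?)
    fix l t
    assume B: "l + 2 * t < Suc k" "entry (q @ [1]) (int l - 1) = 1"
      "\<forall>j\<in>{l..l + 2 * t}. entry (q @ [1]) (int j) = 0"
    have "l \<noteq> 0"
      using B(3) entry_snoc[of q 1 0] by (metis atLeastAtMost_iff le_add1 zero_neq_one order_refl)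
    then obtain l' where l: "l = Suc l'" by (cases l) auto
    have "entry q (int (l' + 2 * t + 1)) = 0"
    proof (rule DeltaD[OF A])
      show "entry q (int l' - 1) = 1"
        using B(2) unfolding l entry_snoc1_pred by simp
      fix j :: nat
      assume "l' \<le> j" "j \<le> l' + 2 * t"
      then show "entry q (int j) = 0"
        using bspec[OF B(3), of "Suc j"] by (simp only: l entry_snoc_Suc) simp
    qed (use B l in simp)
    then show "entry (q @ [1]) (int (l + 2 * t + 1)) = 0"
      using entry_snoc_Suc[of q 1 "l' + 2 * t + 1"] by (simp add: l)
  qed (use A in \<open>auto simp: Delta_def\<close>)
qed

text \<open>The two zeros form a block of their own or lengthen the last block of \<open>q\<close>
  by two; parities are unchanged.\<close>

lemma Delta_snoc_00: "q @ [0, 0] \<in> Delta (Suc (Suc k)) \<longleftrightarrow> q \<in> Delta k"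
proof -
  have e: "entry (q @ [0, 0]) (int (Suc (Suc j))) = entry q (int j)" for j
    using entry_snoc_Suc[of "q @ [0]" 0 "Suc j"] entry_snoc_Suc[of q 0 j] by simp
  have z: "entry (q @ [0, 0]) 0 = 0" "entry (q @ [0, 0]) 1 = 0"
    by (simp_all add: entry_def)
  have p: "entry (q @ [0, 0]) (int (Suc (Suc (Suc l))) - 1) = entry q (int (Suc l) - 1)" for l
    using e[of l] by (simp add: algebra_simps)
  show ?thesis
  proof
    assume A: "q @ [0, 0] \<in> Delta (Suc (Suc k))"
    show "q \<in> Delta k"
      unfolding Delta_def
    proof (intro CollectI conjI allI impI; (elim conjE)?)
      fix l t
      assume B: "l + 2 * t < k" "entry q (int l - 1) = 1" "\<forall>j\<in>{l..l + 2 * t}. entry q (int j) = 0"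
      have "entry (q @ [0, 0]) (int (Suc (Suc (l + 2 * t + 1)))) = 0"
      proof (cases l)
        case 0
        \<comment> \<open>A run of zeros starting at the bottom of \<open>q\<close> merges with the
          two new zeros, hence \<open>Suc t\<close>; any other run is only shifted.\<close>
        have "entry (q @ [0, 0]) (int (0 + 2 * Suc t + 1)) = 0"
        proof (rule DeltaD[OF A])
          fix j :: nat
          assume "j \<le> 0 + 2 * Suc t"
          consider "j = 0" | "j = 1" | j' where "j = Suc (Suc j')"
            by (metis One_nat_def not0_implies_Suc)
          then show "entry (q @ [0, 0]) (int j) = 0"
          proof cases
            case (3 j')
            then show ?thesis
              using bspec[OF B(3), of j'] \<open>j \<le> 0 + 2 * Suc t\<close> 0 by (simp only: e) simp
          qed (use z in simp_all)
        qed (use B 0 in auto)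
        then show ?thesis by (simp add: 0)
      next
        case (Suc l')
        have "entry (q @ [0, 0]) (int (Suc (Suc l) + 2 * t + 1)) = 0"
        proof (rule DeltaD[OF A])
          show "entry (q @ [0, 0]) (int (Suc (Suc l)) - 1) = 1"
            using B(2) by (simp only: Suc p)
          fix j :: nat
          assume "Suc (Suc l) \<le> j" "j \<le> Suc (Suc l) + 2 * t"
          then obtain j' where "j = Suc (Suc j')" "l \<le> j'" "j' \<le> l + 2 * t"
            by (metis Suc_le_D Suc_le_mono add_Suc)
          then show "entry (q @ [0, 0]) (int j) = 0"
            using B(3) by (simp only: e) simp
        qed (use B in simp)
        then show ?thesis by simp
      qed
      then show "entry q (int (l + 2 * t + 1)) = 0"
        by (simp only: e)
    qed (use A in \<open>auto simp: Delta_def\<close>)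
  next
    assume A: "q \<in> Delta k"
    show "q @ [0, 0] \<in> Delta (Suc (Suc k))"
      unfolding Delta_def
    proof (intro CollectI conjI allI impI; (elim conjE)?)
      fix l t
      assume B: "l + 2 * t < Suc (Suc k)" "entry (q @ [0, 0]) (int l - 1) = 1"
        "\<forall>j\<in>{l..l + 2 * t}. entry (q @ [0, 0]) (int j) = 0"
      have B3: "entry q (int j) = 0" if "l \<le> Suc (Suc j)" "Suc (Suc j) \<le> l + 2 * t" for j
        using bspec[OF B(3), of "Suc (Suc j)"] that by (simp only: e) simp
      \<comment> \<open>For \<open>l = 1\<close> and \<open>l = 2\<close> the digit below the run
        would be a new zero, contrary to the assumption that it is 1.\<close>
      consider "l = 0" "t = 0" | t' where "l = 0" "t = Suc t'" | "l = 1" | "l = 2"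
        | l' where "l = Suc (Suc (Suc l'))"
        by (metis One_nat_def Suc_1 not0_implies_Suc)
      then show "entry (q @ [0, 0]) (int (l + 2 * t + 1)) = 0"
      proof cases
        case 1
        then show ?thesis by (simp add: z)
      next
        case 2
        have "entry q (int (0 + 2 * t' + 1)) = 0"
          by (rule DeltaD[OF A]) (use 2 B B3 in auto)
        then show ?thesis using e[of "2 * t' + 1"] 2 by simp
      next
        case 5
        have "entry q (int (Suc l' + 2 * t + 1)) = 0"
        proof (rule DeltaD[OF A])
          show "entry q (int (Suc l') - 1) = 1" using B(2) by (simp only: 5 p)
        qed (use 5 B B3 in auto)
        then show ?thesis using e[of "Suc l' + 2 * t + 1"] 5 by simp
      qed (use B z in auto)
    qed (use A in \<open>auto simp: Delta_def\<close>)
  qed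
qed

text \<open>Since p_{-1} = 1, a final 0 starts a block, and the condition with t = 0 makes the next
  digit 0. The convention p_k = 1 ensures that this digit belongs to \<open>q\<close>.\<close>

lemma Delta_snoc_0: "q @ [0] \<in> Delta (Suc k) \<Longrightarrow> \<exists>q' k'. q = q' @ [0] \<and> k = Suc k'"
proof -
  assume A: "q @ [0] \<in> Delta (Suc k)"
  have "entry (q @ [0]) (int (0 + 2 * 0 + 1)) = 0"
    by (rule DeltaD[OF A]) (auto simp: entry_def)
  then have "entry q 0 = 0" using entry_snoc_Suc[of q 0 0] by simp
  moreover have "length q = k" using A by (simp add: Delta_def)
  ultimately show ?thesis
    by (cases q rule: rev_cases) (auto simp: entry_def split: if_splits)
qed

section \<open>Integers with admissible binary expansions\<close>

lemma eps_Suc: "eps (Suc k) x = eps k (x div 2) @ [x mod 2]"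
proof -
  have "[0..<Suc k] = 0 # map Suc [0..<k]"
    by (simp add: upt_conv_Cons map_Suc_upt del: upt_Suc)
  then show ?thesis
    by (simp add: eps_def rev_map div_mult2_eq del: upt_Suc)
qed

lemma delta_nats_0: "delta_nats 0 = {0}"
  by (auto simp: delta_nats_def eps_def Delta_def)

lemma delta_nats_Suc_odd: "Suc (2 * x) \<in> delta_nats (Suc k) \<longleftrightarrow> x \<in> delta_nats k"
  using Delta_snoc_1 by (auto simp: delta_nats_def eps_Suc)

lemma delta_nats_Suc_even: "2 * x \<in> delta_nats (Suc k) \<longleftrightarrow> (\<exists>y k'. x = 2 * y \<and> k = Suc k' \<and> y \<in> delta_nats k')"
proof
  assume A: "2 * x \<in> delta_nats (Suc k)"
  then have B: "eps k x @ [0] \<in> Delta (Suc k)" "x < 2 ^ k"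
    by (auto simp: delta_nats_def eps_Suc)
  then obtain q' k' where q: "eps k x = q' @ [0]" "k = Suc k'"
    using Delta_snoc_0 by blast
  then have "q' = eps k' (x div 2)" "x mod 2 = 0" by (simp_all add: eps_Suc)
  then show "\<exists>y k'. x = 2 * y \<and> k = Suc k' \<and> y \<in> delta_nats k'"
    using B q Delta_snoc_00[of q' k'] by (auto simp: delta_nats_def intro!: exI[of _ "x div 2"])
next
  assume "\<exists>y k'. x = 2 * y \<and> k = Suc k' \<and> y \<in> delta_nats k'"
  then show "2 * x \<in> delta_nats (Suc k)"
    using Delta_snoc_00 by (auto simp: delta_nats_def eps_Suc)
qed

lemma delta_nats_1: "delta_nats (Suc 0) = {1}"
proof -
  have "x \<in> delta_nats (Suc 0) \<longleftrightarrow> x = 1" for x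
    using delta_nats_Suc_odd[of "x div 2" 0] delta_nats_Suc_even[of "x div 2" 0]
    by (cases "even x") (auto simp: delta_nats_0 elim!: oddE)
  then show ?thesis by blast
qed

text \<open>The expansion ends in 1 or in 00. The two parts differ in parity, and they become the
  two terms of \<open>basis_poly_rec\<close>.\<close>

lemma delta_nats_Suc_Suc: "delta_nats (Suc (Suc k)) = (\<lambda>x. 2 * x + 1) ` delta_nats (Suc k) \<union> (*) 4 ` delta_nats k"
proof -
  have "x \<in> delta_nats (Suc (Suc k)) \<longleftrightarrow> x \<in> (\<lambda>x. 2 * x + 1) ` delta_nats (Suc k) \<union> (*) 4 ` delta_nats k" for x
  proof (cases "even x")
    case True
    then have "x = 2 * (x div 2)" by simp
    then show ?thesis
      using delta_nats_Suc_even[of "x div 2" "Suc k"] True by (auto simp: image_iff)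
  next
    case False
    then have "x = Suc (2 * (x div 2))" by simp
    then show ?thesis
      using delta_nats_Suc_odd[of "x div 2" "Suc k"] False
      by (auto simp: image_iff elim!: oddE) presburger+
  qed
  then show ?thesis by blast
qed

lemma delta_nats_less: "x \<in> delta_nats k \<Longrightarrow> x < 2 ^ k"
  by (simp add: delta_nats_def)

lemma finite_delta_nats [simp]: "finite (delta_nats k)"
  by (rule finite_subset[of _ "{..<2 ^ k}"]) (auto dest: delta_nats_less)

text \<open>The all-ones sequence has no zeros; it supplies the leading monomial of each basis
  polynomial.\<close>

lemma top_in_delta_nats: "2 ^ k - 1 \<in> delta_nats k"
proof (induction k)
  case (Suc k)
  have "2 ^ Suc k - 1 = Suc (2 * (2 ^ k - 1))"
    using one_le_power[of "2::nat" k] unfolding power_Suc by linarith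
  then show ?case using Suc by (simp only: delta_nats_Suc_odd)
qed (simp add: delta_nats_0)

lemma eps_replicate_iff:
  "p < 2 ^ (k + i) \<and> (\<exists>ps\<in>Delta k. eps (k + i) p = ps @ replicate i 0) \<longleftrightarrow> p \<in> (*) (2 ^ i) ` delta_nats k"
proof (induction i arbitrary: p)
  case 0
  show ?case by (auto simp: delta_nats_def)
next
  case (Suc i)
  have "p < 2 ^ (k + Suc i) \<and> (\<exists>ps\<in>Delta k. eps (k + Suc i) p = ps @ replicate (Suc i) 0)
      \<longleftrightarrow> p mod 2 = 0 \<and> (p div 2 < 2 ^ (k + i) \<and> (\<exists>ps\<in>Delta k. eps (k + i) (p div 2) = ps @ replicate i 0))"
    by (auto simp: eps_Suc replicate_append_same[symmetric] simp del: append_assoc simp: append_assoc[symmetric])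
  also have "\<dots> \<longleftrightarrow> p \<in> (*) (2 ^ Suc i) ` delta_nats k"
    unfolding Suc by (auto simp: image_iff)
  finally show ?case .
qed

section \<open>The polynomials \<open>P\<^sub>i\<close>\<close>

text \<open>The exponent of \<open>w\<^sub>3\<close> accompanying \<open>p = 2^i x\<close> in \<open>P\<^sub>i\<close> is \<open>2^i c - 1\<close>, where \<open>c\<close> is this number.\<close>

definition w3_scale :: "nat \<Rightarrow> nat \<Rightarrow> nat" where
  "w3_scale k x = (2 ^ (k + 1) + 1 - 2 * x) div 3"

lemma w3_scale_eqI: "2 * x + 3 * c = 2 ^ (k + 1) + 1 \<Longrightarrow> w3_scale k x = c"
  by (simp add: w3_scale_def flip: add_diff_eq)

text \<open>Filling a pair of zeros at places j, j+1 with ones adds 3 * 2^j, so x is congruent to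
  2^k - 1 modulo 3 and the division is exact. The induction uses the quotients 2c - 1 and 4c -
  1.\<close>

lemma w3_scale: "x \<in> delta_nats k \<Longrightarrow> 2 * x + 3 * w3_scale k x = 2 ^ (k + 1) + 1"
proof -
  assume "x \<in> delta_nats k"
  moreover have "\<forall>x\<in>delta_nats k. \<exists>c. 2 * x + 3 * c = 2 ^ (k + 1) + 1"
  proof (induction k rule: induct_nat_012)
    case 0
    show ?case by (auto simp: delta_nats_0 intro: exI[of _ 1])
  next
    case 1
    show ?case by (auto simp: delta_nats_1 intro: exI[of _ 1])
  next
    case (ge2 k)
    show ?case
    proof
      fix x assume "x \<in> delta_nats (Suc (Suc k))"
      then consider y where "x = 2 * y + 1" "y \<in> delta_nats (Suc k)" | y where "x = 4 * y" "y \<in> delta_nats k"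
        by (auto simp: delta_nats_Suc_Suc)
      then show "\<exists>c. 2 * x + 3 * c = 2 ^ (Suc (Suc k) + 1) + 1"
      proof cases
        case 1
        then obtain c where c: "2 * y + 3 * c = 2 ^ (Suc k + 1) + 1" using ge2 by blast
        \<comment> \<open>The bound on y excludes c = 0, so the subtraction in the witness is not
          truncated.\<close>
        then have "1 \<le> c" using delta_nats_less[OF 1(2)] by simp
        then show ?thesis using c 1 by (intro exI[of _ "2 * c - 1"]) simp
      next
        case 2
        then obtain c where c: "2 * y + 3 * c = 2 ^ (k + 1) + 1" using ge2 by blast
        then have "1 \<le> c" using delta_nats_less[OF 2(2)] by simp
        then show ?thesis using c 2 by (intro exI[of _ "4 * c - 1"]) simp
      qed
    qed
  qed
  ultimately show ?thesis using w3_scale_eqI by blast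
qed

lemma w3_scale_pos: "x \<in> delta_nats k \<Longrightarrow> 1 \<le> w3_scale k x"
  using w3_scale[of x k] delta_nats_less[of x k] by simp

text \<open>The added 1 on the left is what the factor w3^(2^i) contributes in
  \<open>basis_poly_rec\<close>.\<close>

lemma w3_scale_odd: "x \<in> delta_nats (Suc k) \<Longrightarrow> w3_scale (Suc (Suc k)) (2 * x + 1) + 1 = 2 * w3_scale (Suc k) x"
  using w3_scale[of x "Suc k"] w3_scale[of "2 * x + 1" "Suc (Suc k)"] by (simp add: delta_nats_Suc_Suc)

lemma w3_scale_even: "x \<in> delta_nats k \<Longrightarrow> w3_scale (Suc (Suc k)) (4 * x) + 1 = 4 * w3_scale k x"
  using w3_scale[of x k] w3_scale[of "4 * x" "Suc (Suc k)"] by (simp add: delta_nats_Suc_Suc)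

text \<open>This is \<open>P\<^sub>i\<close> for \<open>m = k + i\<close>; recursions and inductions run over \<open>k\<close>.\<close>

definition basis_poly :: "nat \<Rightarrow> nat \<Rightarrow> pol" where
  "basis_poly k i = (\<Sum>x\<in>delta_nats k. mon (2 ^ i * x, 2 ^ i * w3_scale k x - 1))"

text \<open>Multiplying \<open>w3_scale\<close> by 2^i gives t = 2p + 3q with q = 2^i c - 1. Hence
  2p <= t holds automatically and the division by 3 in \<open>P\<close> is exact.\<close>

lemma P_eq_basis_poly:
  assumes "n = 2 ^ (k + i + 1) - 4" "1 \<le> k + i"
  shows "P (k + i) (2 ^ i + n + 1) i = basis_poly k i"
proof -
  let ?t = "2 ^ i + n + 1"
  have n: "n + 4 = 2 ^ i * 2 ^ (k + 1)"
  proof -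
    have "(2::nat) ^ 2 \<le> 2 ^ (k + i + 1)"
      using assms(2) by (intro power_increasing) auto
    then show ?thesis using assms(1) by (simp add: power_add mult_ac)
  qed
  have t: "?t = 2 * (2 ^ i * x) + 3 * (2 ^ i * w3_scale k x - 1)" if "x \<in> delta_nats k" for x
  proof -
    have "2 ^ i * (2 * x + 3 * w3_scale k x) = 2 ^ i * (2 ^ (k + 1) + 1)"
      using w3_scale[OF that] by simp
    then have "2 * (2 ^ i * x) + 3 * (2 ^ i * w3_scale k x) = n + 4 + 2 ^ i"
      using n by (simp add: algebra_simps)
    moreover have "1 \<le> 2 ^ i * w3_scale k x" using w3_scale_pos[OF that] by simp
    ultimately show ?thesis by linarith
  qed
  have "{p. p < 2 ^ (k + i) \<and> 2 * p \<le> ?t \<and> (\<exists>ps\<in>Delta (k + i - i). eps (k + i) p = ps @ replicate i 0)}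
      = (*) (2 ^ i) ` delta_nats k"
  proof (intro set_eqI)
    fix p
    have "2 * p \<le> ?t" if "p \<in> (*) (2 ^ i) ` delta_nats k"
      using t that by fastforce
    then show "p \<in> {p. p < 2 ^ (k + i) \<and> 2 * p \<le> ?t \<and>
        (\<exists>ps\<in>Delta (k + i - i). eps (k + i) p = ps @ replicate i 0)} \<longleftrightarrow> p \<in> (*) (2 ^ i) ` delta_nats k"
      using eps_replicate_iff[of p k i] by auto
  qed
  then have "P (k + i) ?t i = (\<Sum>p\<in>(*) (2 ^ i) ` delta_nats k. mon (p, (?t - 2 * p) div 3))"
    by (simp only: P_def monomial_eq_mon)
  also have "\<dots> = (\<Sum>x\<in>delta_nats k. mon (2 ^ i * x, (?t - 2 * (2 ^ i * x)) div 3))"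
    by (subst sum.reindex) (auto simp: inj_on_def)
  also have "\<dots> = basis_poly k i"
    unfolding basis_poly_def by (intro sum.cong refl) (simp only: t, simp)
  finally show ?thesis .
qed

lemma basis_poly_0: "basis_poly 0 i = w3 ^ (2 ^ i - 1)"
  by (simp add: basis_poly_def delta_nats_0 w3_scale_def w3_power)

lemma basis_poly_1: "basis_poly (Suc 0) i = w2 ^ 2 ^ i * w3 ^ (2 ^ i - 1)"
  by (simp add: basis_poly_def delta_nats_1 w3_scale_def monomial_eq_mon)

text \<open>Split the sum by the final digits of x: x = 2y + 1 yields the factor w2^(2^i) and scale
  2^(i+1), and x = 4y yields scale 2^(i+2).\<close>

lemma basis_poly_rec:
  "w3 ^ 2 ^ i * basis_poly (Suc (Suc k)) i = w2 ^ 2 ^ i * basis_poly (Suc k) (Suc i) + basis_poly k (Suc (Suc i))"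
proof -
  let ?F = "\<lambda>x. mon (2 ^ i * x, 2 ^ i * (w3_scale (Suc (Suc k)) x + 1) - 1)"
  have "w3 ^ 2 ^ i * basis_poly (Suc (Suc k)) i = sum ?F (delta_nats (Suc (Suc k)))"
    unfolding basis_poly_def sum_distrib_left
    by (intro sum.cong refl) (auto simp: w3_power mon_mult dest!: w3_scale_pos)
  also have "\<dots> = sum ?F ((\<lambda>x. 2 * x + 1) ` delta_nats (Suc k)) + sum ?F ((*) 4 ` delta_nats k)"
    unfolding delta_nats_Suc_Suc by (rule sum.union_disjoint) (auto, presburger)
  also have "sum ?F ((\<lambda>x. 2 * x + 1) ` delta_nats (Suc k)) = (\<Sum>x\<in>delta_nats (Suc k). ?F (2 * x + 1))"
    by (subst sum.reindex) (auto simp: inj_on_def)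
  also have "\<dots> = (\<Sum>x\<in>delta_nats (Suc k). mon (2 ^ i * (2 * x + 1), 2 ^ i * (2 * w3_scale (Suc k) x) - 1))"
    by (intro sum.cong refl) (simp only: w3_scale_odd)
  also have "sum ?F ((*) 4 ` delta_nats k) = (\<Sum>x\<in>delta_nats k. ?F (4 * x))"
    by (subst sum.reindex) (auto simp: inj_on_def)
  also have "\<dots> = (\<Sum>x\<in>delta_nats k. mon (2 ^ i * (4 * x), 2 ^ i * (4 * w3_scale k x) - 1))"
    by (intro sum.cong refl) (simp only: w3_scale_even)
  also have "(\<Sum>x\<in>delta_nats (Suc k). mon (2 ^ i * (2 * x + 1), 2 ^ i * (2 * w3_scale (Suc k) x) - 1))
      + (\<Sum>x\<in>delta_nats k. mon (2 ^ i * (4 * x), 2 ^ i * (4 * w3_scale k x) - 1))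
      = w2 ^ 2 ^ i * basis_poly (Suc k) (Suc i) + basis_poly k (Suc (Suc i))"
    unfolding basis_poly_def sum_distrib_left
    by (simp add: w2_power mon_mult algebra_simps)
  finally show ?thesis .
qed

lemma w3_neq_0: "w3 \<noteq> 0"
  by (metis w3_def keys_single keys_zero insert_not_empty zero_neq_one)

text \<open>Both sides obey the same three-term relation, in which k + i is constant on the right
  and on the left; w3^(2^i) cancels because the ring is an integral domain.\<close>

lemma basis_poly_eq_g: "basis_poly k i = g (2 ^ i + 2 ^ (k + i + 1) - 3)"
proof (induction k arbitrary: i rule: induct_nat_012)
  case 0
  show ?case using g_three_pow2_minus_3[of i] by (simp add: basis_poly_0)
next
  case 1
  \<comment> \<open>This is the index for k = 1. Adding 3 * 2^i reaches 2^(i+3) - 3, where g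
    vanishes; adding 2^i reaches 3 * 2^(i+1) - 3, where g is a power of w3.\<close>
  let ?r = "5 * 2 ^ i - 3 :: nat"
  have p: "(1::nat) \<le> 2 ^ i" by simp
  have e: "?r + 3 * 2 ^ i = 2 ^ (Suc i + 2) - 3" "?r + 2 ^ i = 3 * 2 ^ Suc i - 3"
    "2 ^ Suc i - 1 = 2 ^ i + (2 ^ i - (1::nat))"
    using p unfolding power_add power_Suc by (simp_all only: power2_eq_square)
  have "w2 ^ 2 ^ i * w3 ^ (2 ^ Suc i - 1) + w3 ^ 2 ^ i * g ?r = 0"
    using g_rec_pow[of ?r i] unfolding e(1,2) g_pow2_minus_3 g_three_pow2_minus_3 by simp
  then have "w3 ^ 2 ^ i * g ?r = w2 ^ 2 ^ i * w3 ^ (2 ^ Suc i - 1)"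
    using pol_add_self by (metis add_left_cancel)
  then have "w3 ^ 2 ^ i * g ?r = w3 ^ 2 ^ i * basis_poly (Suc 0) i"
    unfolding e(3) basis_poly_1 power_add by (rule trans[OF _ mult.left_commute])
  then have "g ?r = basis_poly (Suc 0) i" using w3_neq_0 by simp
  then show ?case by simp
next
  case (ge2 k)
  let ?r = "2 ^ i + 2 ^ (k + i + 3) - 3 :: nat"
  have large: "(8::nat) \<le> 2 ^ (k + i + 3)" by (simp add: power_add)
  have *: "k + Suc (Suc i) + 1 = k + i + 3" "Suc k + Suc i + 1 = k + i + 3" by simp_all
  have e: "?r + 3 * 2 ^ i = 2 ^ Suc (Suc i) + 2 ^ (k + Suc (Suc i) + 1) - 3"
    "?r + 2 ^ i = 2 ^ Suc i + 2 ^ (Suc k + Suc i + 1) - 3"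
    unfolding * power_Suc using large by linarith+
  have "basis_poly k (Suc (Suc i)) = w2 ^ 2 ^ i * basis_poly (Suc k) (Suc i) + w3 ^ 2 ^ i * g ?r"
    using g_rec_pow[of ?r i] unfolding e ge2 .
  then have "w3 ^ 2 ^ i * basis_poly (Suc (Suc k)) i = w3 ^ 2 ^ i * g ?r"
    by (simp only: basis_poly_rec add.assoc[symmetric] pol_add_self add_0_left)
  then have "g ?r = basis_poly (Suc (Suc k)) i" using w3_neq_0 by simp
  moreover have "k + i + 3 = Suc (Suc k) + i + 1" by simp
  ultimately show ?case by simp
qed

section \<open>Leading exponents\<close>

text \<open>As a relation this excludes the zero polynomial, and no coefficient needs recording
  because it can only be 1.\<close>

definition leads :: "pol \<Rightarrow> nat \<times> nat \<Rightarrow> bool" where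
  "leads f e \<longleftrightarrow> e \<in> Poly_Mapping.keys f \<and> (\<forall>d\<in>Poly_Mapping.keys f. d \<le> e)"

lemma lead_term_eq: "leads f e \<Longrightarrow> lead_term f = mon e"
proof -
  assume "leads f e"
  then have "Max (Poly_Mapping.keys f) = e" "f \<noteq> 0" "Poly_Mapping.lookup f e = 1"
    by (auto simp: leads_def in_keys_iff intro!: Max_eqI)
  then show ?thesis by (simp add: lead_term_def Let_def)
qed

lemma leads_mon_mult:
  assumes "leads f e"
  shows "leads (mon d * f) (d + e)"
  unfolding leads_def
proof
  show "d + e \<in> Poly_Mapping.keys (mon d * f)"
    using assms by (simp add: leads_def in_keys_iff)
  show "\<forall>x\<in>Poly_Mapping.keys (mon d * f). x \<le> d + e"
  proof
    fix x assume "x \<in> Poly_Mapping.keys (mon d * f)"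
    then obtain b where "x = d + b" "b \<in> Poly_Mapping.keys f"
      using keys_mult[of "mon d" f] by auto
    moreover from this have "b \<le> e" using assms unfolding leads_def by blast
    ultimately show "x \<le> d + e" by (simp only: add_left_mono)
  qed
qed

text \<open>The largest of the distinct leading exponents occurs in exactly one summand, so it
  cannot cancel.\<close>

lemma leads_sum:
  assumes "finite T" "T \<noteq> {}" "inj_on e T" "\<And>t. t \<in> T \<Longrightarrow> leads (h t) (e t)"
  shows "\<exists>t\<in>T. leads (\<Sum>t\<in>T. h t) (e t)"
proof -
  have "Max (e ` T) \<in> e ` T" using assms(1,2) by (intro Max_in) auto
  then obtain s where s: "s \<in> T" "e s = Max (e ` T)" by (metis imageE)
  have le: "e t \<le> e s" if "t \<in> T" for t
    unfolding s(2) using that assms(1) by (intro Max_ge) auto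
  have "Poly_Mapping.lookup (h t) (e s) = (if t = s then 1 else 0)" if "t \<in> T" for t
  proof (cases "t = s")
    case True
    then show ?thesis using assms(4)[OF that] by (simp add: leads_def in_keys_iff)
  next
    case False
    then have "e t \<noteq> e s" using assms(3) s(1) that by (metis inj_onD)
    then have "e s \<notin> Poly_Mapping.keys (h t)"
      using assms(4)[OF that] le[OF that] unfolding leads_def by (metis order_antisym)
    then show ?thesis using False by (simp add: in_keys_iff)
  qed
  then have "Poly_Mapping.lookup (\<Sum>t\<in>T. h t) (e s) = 1"
    using assms(1) s(1) by (simp add: lookup_sum cong: sum.cong)
  moreover have "d \<le> e s" if "d \<in> Poly_Mapping.keys (\<Sum>t\<in>T. h t)" for d
  proof -
    obtain t where "t \<in> T" "d \<in> Poly_Mapping.keys (h t)"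
      using \<open>d \<in> _\<close> keys_sum[of h T] by blast
    then show ?thesis
      using assms(4) le unfolding leads_def by (meson order_trans)
  qed
  ultimately show ?thesis
    using s(1) by (auto simp: leads_def in_keys_iff)
qed

text \<open>The exponent of w2 is largest at x = 2^k - 1, where the scale is 1.
  \<open>leads_sum\<close> only provides some x; the occurrence of the top exponent then identifies
  it.\<close>

lemma leads_basis_poly: "leads (basis_poly k i) (2 ^ i * (2 ^ k - 1), 2 ^ i - 1)"
proof -
  have top: "w3_scale k (2 ^ k - 1) = 1"
    by (rule w3_scale_eqI) (use one_le_power[of "2::nat" k] in \<open>simp only: Suc_eq_plus1[symmetric] power_Suc, linarith\<close>)
  have "\<exists>x\<in>delta_nats k. leads (basis_poly k i) (2 ^ i * x, 2 ^ i * w3_scale k x - 1)"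
    unfolding basis_poly_def
    by (rule leads_sum) (use top_in_delta_nats in \<open>auto simp: inj_on_def leads_def\<close>)
  then obtain x where x: "x \<in> delta_nats k" "leads (basis_poly k i) (2 ^ i * x, 2 ^ i * w3_scale k x - 1)" by blast
  have "(2 ^ i * (2 ^ k - 1), 2 ^ i * w3_scale k (2 ^ k - 1) - 1) \<in> Poly_Mapping.keys (basis_poly k i)"
  proof -
    have "Poly_Mapping.lookup (basis_poly k i) (2 ^ i * (2 ^ k - 1), 2 ^ i * w3_scale k (2 ^ k - 1) - 1)
        = (\<Sum>x\<in>delta_nats k. if x = 2 ^ k - 1 then 1 else 0)"
      unfolding basis_poly_def lookup_sum by (intro sum.cong refl) (auto simp: lookup_single when_def)
    then show ?thesis using top_in_delta_nats by (simp add: in_keys_iff)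
  qed
  then have "(2 ^ i * (2 ^ k - 1), 2 ^ i * w3_scale k (2 ^ k - 1) - 1) \<le> (2 ^ i * x, 2 ^ i * w3_scale k x - 1)"
    using x(2) unfolding leads_def by blast
  then have "2 ^ k - 1 \<le> x" by (auto simp: less_eq_prod_def)
  then have "x = 2 ^ k - 1" using delta_nats_less[OF x(1)] by simp
  then show ?thesis using x(2) top by simp
qed

section \<open>Normal forms in the ideal\<close>

lemma ideal_gen_base: "b \<in> B \<Longrightarrow> b \<in> ideal_gen B"
  unfolding ideal_gen_def by (rule module.span_base[OF module_times])

lemma ideal_gen_add: "a \<in> ideal_gen B \<Longrightarrow> b \<in> ideal_gen B \<Longrightarrow> a + b \<in> ideal_gen B"
  unfolding ideal_gen_def by (rule module.span_add[OF module_times])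

lemma ideal_gen_mult: "a \<in> ideal_gen B \<Longrightarrow> c * a \<in> ideal_gen B"
  unfolding ideal_gen_def by (rule module.span_scale[OF module_times])

lemma ideal_gen_minimal: "A \<subseteq> ideal_gen B \<Longrightarrow> ideal_gen A \<subseteq> ideal_gen B"
  unfolding ideal_gen_def
  by (rule module.span_minimal[OF module_times _ module.subspace_span[OF module_times]])

lemma ideal_gen_induct [consumes 1, case_names zero add mult base]:
  assumes "f \<in> ideal_gen B" "Q 0" "\<And>a b. Q a \<Longrightarrow> Q b \<Longrightarrow> Q (a + b)"
    "\<And>c a. Q a \<Longrightarrow> Q (c * a)" "\<And>b. b \<in> B \<Longrightarrow> Q b"
  shows "Q f"
  using module.span_induct[OF module_times, of f B Q] assms
  by (auto simp: ideal_gen_def module.subspace_def[OF module_times])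

text \<open>In characteristic 2 the common summands cancel, which lets plain index sets represent
  linear combinations.\<close>

lemma sum_sym_diff:
  fixes h :: "'b \<Rightarrow> pol"
  assumes "finite A" "finite B"
  shows "sum h A + sum h B = sum h (A - B \<union> (B - A))"
proof -
  have "sum h A + sum h B = (sum h (A \<inter> B) + sum h (A \<inter> B)) + (sum h (A - B) + sum h (B - A))"
    using sum.Int_Diff[OF assms(1), of h B] sum.Int_Diff[OF assms(2), of h A]
    by (simp only: Int_commute[of B A] add.assoc add.left_commute)
  also have "\<dots> = sum h (A - B \<union> (B - A))"
    unfolding pol_add_self using assms by (subst sum.union_disjoint) auto
  finally show ?thesis .
qed

text \<open>The bound on v makes the numbers v + 2^i - 1, the w3-exponents of the leading terms,
  fall into disjoint intervals for different i; the interval for i = m is unbounded.\<close>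

definition normal_sums :: "nat \<Rightarrow> pol set" where
  "normal_sums m = {\<Sum>(i, u, v)\<in>T. mon (u, v) * basis_poly (m - i) i | T.
     finite T \<and> T \<subseteq> {(i, u, v). i \<le> m \<and> (i < m \<longrightarrow> v < 2 ^ i)}}"

lemma normal_sums_0: "0 \<in> normal_sums m"
  unfolding normal_sums_def by (auto intro: exI[of _ "{}"])

lemma normal_sums_add:
  assumes "a \<in> normal_sums m" "b \<in> normal_sums m"
  shows "a + b \<in> normal_sums m"
proof -
  let ?h = "\<lambda>(i, u, v). mon (u, v) * basis_poly (m - i) i"
  let ?I = "{(i, u, v). i \<le> m \<and> (i < m \<longrightarrow> v < 2 ^ i)}"
  obtain A B where "finite A" "A \<subseteq> ?I" "a = sum ?h A" "finite B" "B \<subseteq> ?I" "b = sum ?h B"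
    using assms unfolding normal_sums_def by blast
  then show ?thesis
    unfolding normal_sums_def
    by (intro CollectI exI[of _ "A - B \<union> (B - A)"]) (auto simp: sum_sym_diff)
qed

lemma normal_sums_sum: "(\<And>x. x \<in> X \<Longrightarrow> F x \<in> normal_sums m) \<Longrightarrow> sum F X \<in> normal_sums m"
  by (induction X rule: infinite_finite_induct) (auto intro: normal_sums_0 normal_sums_add)

text \<open>If i < m and v >= 2^i, split off w3^(2^i) and apply \<open>basis_poly_rec\<close>. The
  index i rises to i + 1 and i + 2, so the process ends, at the latest at i = m, where v is
  unrestricted.\<close>

lemma normal_sums_mon_basis_poly: "i \<le> m \<Longrightarrow> mon (u, v) * basis_poly (m - i) i \<in> normal_sums m"
proof (induction "m - i" arbitrary: i u v rule: less_induct)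
  case less
  note outer = less
  show ?case
  proof (induction v arbitrary: u rule: less_induct)
    case (less v)
    show ?case
    proof (cases "i < m \<longrightarrow> v < 2 ^ i")
      case True
      then show ?thesis
        unfolding normal_sums_def using outer(2)
        by (intro CollectI exI[of _ "{(i, u, v)}"]) auto
    next
      case False
      then have i: "i < m" "2 ^ i \<le> v" by auto
      let ?v = "v - 2 ^ i"
      have "mon (u, v) = mon (u, ?v) * w3 ^ 2 ^ i"
        using i by (simp add: w3_power mon_mult)
      then have *: "mon (u, v) * basis_poly (m - i) i = mon (u, ?v) * (w3 ^ 2 ^ i * basis_poly (m - i) i)"
        by (simp add: mult.assoc)
      have **: "mon (u, ?v) * (w2 ^ 2 ^ i * f) = mon (u + 2 ^ i, ?v) * f" for f
        by (simp add: w2_power mon_mult mult.assoc[symmetric])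
      have S: "mon (u', ?v) * basis_poly (m - Suc i) (Suc i) \<in> normal_sums m" for u'
        using outer(1)[of "Suc i"] i by simp
      show ?thesis
      proof (cases "m - i")
        case 0
        then show ?thesis using i by simp
      next
        case (Suc k)
        show ?thesis
        proof (cases k)
          case 0
          \<comment> \<open>Here i = m - 1 and the relation has a single term on the right, P_{m+1}
            being 0.\<close>
          have "w3 ^ 2 ^ i * basis_poly (m - i) i = w2 ^ 2 ^ i * w3 ^ (2 ^ Suc i - 1)"
            using one_le_power[of "2::nat" i]
            by (simp add: Suc 0 basis_poly_1 mult.left_commute power_add[symmetric] mult_2)
          also have "w3 ^ (2 ^ Suc i - 1) = basis_poly (m - Suc i) (Suc i)"
            using Suc 0 basis_poly_0[of "Suc i"] by (metis Suc_diff_Suc i(1) nat.inject)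
          finally show ?thesis using S unfolding * by (simp add: **)
        next
          case (Suc k')
          have m: "m - i = Suc (Suc k')" "m - Suc i = Suc k'" "m - Suc (Suc i) = k'" "Suc (Suc i) \<le> m"
            using Suc \<open>m - i = Suc k\<close> by simp_all
          have "mon (u, ?v) * basis_poly (m - Suc (Suc i)) (Suc (Suc i)) \<in> normal_sums m"
            using outer(1)[of "Suc (Suc i)"] m by simp
          then show ?thesis
            using S unfolding * unfolding m basis_poly_rec distrib_left ** by (intro normal_sums_add)
        qed
      qed
    qed
  qed
qed

lemma normal_sums_mult: "a \<in> normal_sums m \<Longrightarrow> c * a \<in> normal_sums m"
proof -
  assume "a \<in> normal_sums m"
  then obtain T where T: "T \<subseteq> {(i, u, v). i \<le> m \<and> (i < m \<longrightarrow> v < 2 ^ i)}"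
    "a = (\<Sum>(i, u, v)\<in>T. mon (u, v) * basis_poly (m - i) i)"
    unfolding normal_sums_def by blast
  have "mon e * (mon (u, v) * basis_poly (m - i) i) \<in> normal_sums m" if "(i, u, v) \<in> T" for e i u v
  proof -
    have "mon e * (mon (u, v) * basis_poly (m - i) i) = mon (fst e + u, snd e + v) * basis_poly (m - i) i"
      by (cases e) (simp add: mon_mult flip: mult.assoc)
    moreover have "i \<le> m" using that T(1) by auto
    ultimately show ?thesis by (simp only: normal_sums_mon_basis_poly)
  qed
  then have "(\<Sum>e\<in>Poly_Mapping.keys c. mon e * a) \<in> normal_sums m"
    unfolding T(2) sum_distrib_left by (intro normal_sums_sum) auto
  then show ?thesis by (subst pol_eq_sum_mon[of c]) (simp add: sum_distrib_right)
qed

text \<open>The left side is below 2^(i+1) - 1, hence below 2^j - 1.\<close>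

lemma pow2_block_unique:
  assumes "2 ^ i - 1 + v = 2 ^ j - 1 + (w::nat)" "v < 2 ^ i" "i < j"
  shows False
proof -
  have "2 ^ Suc i \<le> (2::nat) ^ j" using assms(3) by (intro power_increasing) auto
  then show False using assms one_le_power[of "2::nat" i] by simp
qed

text \<open>The leading exponents of the summands are distinct: the second entry determines i and
  then v, the first entry determines u.\<close>

lemma normal_sums_lead:
  assumes "f \<in> normal_sums m" "f \<noteq> 0"
  shows "\<exists>i\<le>m. \<exists>d. lead_term f = mon d * lead_term (basis_poly (m - i) i)"
proof -
  let ?h = "\<lambda>(i, u, v). mon (u, v) * basis_poly (m - i) i"
  let ?e = "\<lambda>(i, u, v). (u, v) + (2 ^ i * (2 ^ (m - i) - 1), 2 ^ i - 1) :: nat \<times> nat"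
  obtain T where T: "finite T" "T \<subseteq> {(i, u, v). i \<le> m \<and> (i < m \<longrightarrow> v < 2 ^ i)}" "f = sum ?h T"
    using assms(1) unfolding normal_sums_def by blast
  have "inj_on ?e T"
  proof (rule inj_onI)
    fix s t assume st: "s \<in> T" "t \<in> T" "?e s = ?e t"
    obtain i u v j u' v' where [simp]: "s = (i, u, v)" "t = (j, u', v')" by (cases s, cases t)
    have eq: "2 ^ i - 1 + v = 2 ^ j - 1 + v'" using st(3) by (simp add: add.commute)
    have "i \<le> m" "j \<le> m" "i < m \<longrightarrow> v < 2 ^ i" "j < m \<longrightarrow> v' < 2 ^ j"
      using st(1,2) T(2) by auto
    \<comment> \<open>If the indices differ, the smaller one is below m, so its bound on v is
      available.\<close>
    then have "i = j"
      using pow2_block_unique[OF eq] pow2_block_unique[OF eq[symmetric]]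
      by (cases i j rule: linorder_cases) auto
    moreover have "v = v'"
      using eq \<open>i = j\<close> by (simp only: add_left_cancel)
    ultimately show "s = t" using st(3) by simp
  qed
  moreover have "T \<noteq> {}" using assms(2) T(3) by auto
  moreover have "leads (?h t) (?e t)" for t
    using leads_mon_mult[OF leads_basis_poly] by (cases t) (simp only: case_prod_conv)
  ultimately obtain t where t: "t \<in> T" "leads f (?e t)"
    unfolding T(3) using leads_sum[OF T(1), of ?e ?h] by blast
  obtain i u v where [simp]: "t = (i, u, v)" by (cases t)
  have "lead_term f = mon (u, v) * lead_term (basis_poly (m - i) i)"
    using lead_term_eq[OF t(2)] lead_term_eq[OF leads_basis_poly[of "m - i" i]] by (simp add: mon_mult)
  then show ?thesis using t(1) T(2) by auto
qed

section \<open>The leading ideal of \<open>J n\<close>\<close>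

theorem theorem4p7:
  fixes m n :: nat
  assumes "m \<ge> 2" and "n = 2 ^ (m + 1) - 4"
  shows "groebner_basis ((\<lambda>i. P m (2 ^ i + n + 1) i) ` {0..m}) (J n)"
proof -
  let ?G = "(\<lambda>i. basis_poly (m - i) i) ` {0..m}"
  have G: "(\<lambda>i. P m (2 ^ i + n + 1) i) ` {0..m} = ?G"
  proof (intro image_cong refl)
    fix i assume "i \<in> {0..m}"
    then show "P m (2 ^ i + n + 1) i = basis_poly (m - i) i"
      using P_eq_basis_poly[of n "m - i" i] assms by simp
  qed
  have "(2::nat) ^ 2 \<le> 2 ^ (m + 1)" using assms(1) by (intro power_increasing) auto
  \<comment> \<open>These forms show that the first generator vanishes and that the other two are
    P_0 and P_1.\<close>
  then have n: "n + 1 = 2 ^ (m - 1 + 2) - 3" "n + 2 = 2 ^ 0 + 2 ^ (m + 0 + 1) - 3"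
    "n + 3 = 2 ^ 1 + 2 ^ (m - 1 + 1 + 1) - 3"
    using assms by simp_all
  have J: "J n = ideal_gen {0, basis_poly m 0, basis_poly (m - 1) 1}"
    unfolding J_def n g_pow2_minus_3 basis_poly_eq_g ..
  have mem: "basis_poly (m - i) i \<in> J n" if "i \<le> m" for i
    using that
  proof (induction i rule: induct_nat_012)
    case (ge2 i)
    then have m: "m - i = Suc (Suc (m - Suc (Suc i)))" "m - Suc i = Suc (m - Suc (Suc i))" by simp_all
    \<comment> \<open>The three-term relation solved for P_{i+2}, signs being irrelevant in
      characteristic 2.\<close>
    have "basis_poly (m - Suc (Suc i)) (Suc (Suc i)) = w2 ^ 2 ^ i * basis_poly (m - Suc i) (Suc i) + w3 ^ 2 ^ i * basis_poly (m - i) i"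
      unfolding m basis_poly_rec by (simp add: add.assoc[symmetric] pol_add_self)
    then show ?case using ge2 unfolding J by (simp add: ideal_gen_add ideal_gen_mult)
  qed (simp_all add: J ideal_gen_base)
  have lead: "lead_term f \<in> ideal_gen (lead_term ` ?G)" if "f \<in> J n" "f \<noteq> 0" for f
  proof -
    have "f \<in> normal_sums m"
      using \<open>f \<in> J n\<close> unfolding J
    proof (induction rule: ideal_gen_induct)
      case (base b)
      then show ?case
        using normal_sums_0 normal_sums_mon_basis_poly[of 0 m 0 0] normal_sums_mon_basis_poly[of 1 m 0 0] assms(1)
        by (auto simp: zero_prod_def[symmetric])
    qed (auto intro: normal_sums_0 normal_sums_add normal_sums_mult)
    then obtain i d where "i \<le> m" "lead_term f = mon d * lead_term (basis_poly (m - i) i)"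
      using normal_sums_lead \<open>f \<noteq> 0\<close> by blast
    then show ?thesis by (simp add: ideal_gen_mult ideal_gen_base)
  qed
  have "basis_poly k i \<noteq> 0" for k i
    using leads_basis_poly[of k i] by (auto simp: leads_def)
  then have "lead_term ` ?G \<subseteq> ideal_gen (lead_term ` (J n - {0}))"
    using mem by (auto intro!: ideal_gen_base)
  then have "ideal_gen (lead_term ` (J n - {0})) = ideal_gen (lead_term ` ?G)"
    using lead by (intro equalityI ideal_gen_minimal) auto
  then show ?thesis
    unfolding G groebner_basis_def using mem by auto
qed

end
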